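(* Let $P(\lambda)=A_m\lambda^m+\cdots+A_1\lambda+A_0$ be a weakly normal $n\times n$ matrix polynomial with $A_0,\dots,A_m\in\mathbb{C}^{n\times n}$ and $\det(A_m)\neq 0$, and let $\mu\in\mathbb{C}\setminus\sigma(P')$, i.e. $\mu\in\mathbb{C}$ is such that $P'(\mu)$ is nonsingular. Suppose that $\gamma_*>0$ is a point where the function $\gamma\mapsto s_{2n-1}(F[P(\mu);\gamma])$, $\gamma\in[0,+\infty)$, attains its maximum value, and suppose that $s_*=s_{2n-1}(F[P(\mu);\gamma_*])>0$. Then $s_*$ is a multiple singular value of $F[P(\mu);\gamma_*]$, i.e. at least two of the $2n$ singular values of $F[P(\mu);\gamma_*]$ (counted with multiplicity) are equal to $s_*$.
   Context: A matrix polynomial $P(\lambda)=A_m\lambda^m+\cdots+A_1\lambda+A_0$ with $A_j\in\mathbb{C}^{n\times n}$ is called weakly normal if there exists a unitary matrix $U\in\mathbb{C}^{n\times n}$ such that $U^*P(\lambda)U$ is a diagonal matrix polynomial (equivalently, $U^*A_jU$ is diagonal for every $j=0,1,\dots,m$). $P'(\lambda)$ denotes the derivative of $P(\lambda)$ with respect to $\lambda$, and $\sigma(P')$ is the set of $\lambda_0\in\mathbb{C}$ for which $P'(\lambda_0)x_0=0$ for some nonzero $x_0\in\mathbb{C}^n$. For real $\gamma\ge 0$, $F[P(\mu);\gamma]$ denotes the $2n\times 2n$ complex matrix $$F[P(\mu);\gamma]=\begin{bmatrix} P(\mu) & 0\\ \gamma P'(\mu) & P(\mu)\end{bmatrix}.$$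 For a matrix $B$, $s_1(B)\ge s_2(B)\ge s_3(B)\ge\cdots$ denote its singular values in nonincreasing order, counted with multiplicity. *)

theory Defs
  imports "Jordan_Normal_Form.Schur_Decomposition"
begin

text \<open>
  A matrix polynomial is a matrix with polynomial entries; \<open>matpoly n m A\<close> is
  \<open>A 0 + A 1 \<lambda> + \<dots> + A m \<lambda>^m\<close>, where only the coefficients \<open>A j\<close> with \<open>j \<le> m\<close> matter.
\<close>

definition matpoly :: "nat \<Rightarrow> nat \<Rightarrow> (nat \<Rightarrow> complex mat) \<Rightarrow> complex poly mat" where
  "matpoly n m A = mat n n (\<lambda>(i, j). \<Sum>k\<le>m. monom (A k $$ (i, j)) k)"

definition matpoly_eval :: "complex poly mat \<Rightarrow> complex \<Rightarrow> complex mat" where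
  "matpoly_eval P z = map_mat (\<lambda>p. poly p z) P"

definition matpoly_deriv :: "complex poly mat \<Rightarrow> complex poly mat" where
  "matpoly_deriv P = map_mat pderiv P"

definition matpoly_spectrum :: "complex poly mat \<Rightarrow> complex set" where
  "matpoly_spectrum P =
     {z. \<exists>x \<in> carrier_vec (dim_col P).
           x \<noteq> 0\<^sub>v (dim_col P) \<and> matpoly_eval P z *\<^sub>v x = 0\<^sub>v (dim_row P)}"

definition unitary_mat :: "nat \<Rightarrow> complex mat \<Rightarrow> bool" where
  "unitary_mat n U \<longleftrightarrow> U \<in> carrier_mat n n \<and> mat_adjoint U * U = 1\<^sub>m n"

definition const_matpoly :: "complex mat \<Rightarrow> complex poly mat" where
  "const_matpoly B = map_mat (\<lambda>c. [:c:]) B"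

definition weakly_normal :: "nat \<Rightarrow> complex poly mat \<Rightarrow> bool" where
  "weakly_normal n P \<longleftrightarrow> P \<in> carrier_mat n n \<and>
     (\<exists>U. unitary_mat n U \<and>
        diagonal_mat (const_matpoly (mat_adjoint U) * P * const_matpoly U))"

definition F_mat :: "complex poly mat \<Rightarrow> complex \<Rightarrow> real \<Rightarrow> complex mat" where
  "F_mat P z \<gamma> =
     four_block_mat (matpoly_eval P z) (0\<^sub>m (dim_row P) (dim_col P))
       (complex_of_real \<gamma> \<cdot>\<^sub>m matpoly_eval (matpoly_deriv P) z) (matpoly_eval P z)"

text \<open>
  The singular values of a square matrix \<open>B\<close>, with multiplicity, are the square roots of the
  eigenvalues of \<open>B\<^sup>*B\<close>, taken with algebraic multiplicity. These eigenvalues are real and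
  nonnegative, so \<open>Re\<close> discards nothing.
\<close>

definition singular_values :: "complex mat \<Rightarrow> real multiset" where
  "singular_values B = image_mset (\<lambda>z. sqrt (Re z)) (proots (char_poly (mat_adjoint B * B)))"

text \<open>
  The \<open>k\<close>-th largest singular value, numbered from \<open>1\<close>; meaningful only for \<open>1 \<le> k \<le> N\<close>
  when \<open>B\<close> is \<open>N \<times> N\<close>.
\<close>

definition singular_value :: "nat \<Rightarrow> complex mat \<Rightarrow> real" where
  "singular_value k B = rev (sorted_list_of_multiset (singular_values B)) ! (k - 1)"

lemma size_singular_values:
  assumes "B \<in> carrier_mat N N"
  shows "size (singular_values B) = N"
proof -
  have "mat_adjoint B * B \<in> carrier_mat N N"
    using assms by (auto simp: mat_adjoint_def)
  then have "degree (char_poly (mat_adjoint B * B)) = N"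
    by (rule degree_monic_char_poly[THEN conjunct1])
  then show ?thesis
    by (simp add: singular_values_def size_proots_complex)
qed

lemma matpoly_eval_matpoly:
  "matpoly_eval (matpoly n m A) z = mat n n (\<lambda>ij. \<Sum>k\<le>m. A k $$ ij * z ^ k)"
  by (rule eq_matI) (auto simp: matpoly_eval_def matpoly_def poly_sum poly_monom)

end

theory Submission
  imports Defs
begin

text \<open>
  A unitary matrix \<open>U\<close> that diagonalizes all coefficients of \<open>P\<close> also diagonalizes \<open>P(\<mu>)\<close> and
  \<open>P'(\<mu>)\<close>, and conjugation by \<open>diag(U, U)\<close> does not change the singular values of
  \<open>F[P(\<mu>);\<gamma>]\<close>. After a permutation of the basis, \<open>F[P(\<mu>);\<gamma>]\<close> is therefore a direct sum of the
  blocks with rows \<open>(a, 0)\<close> and \<open>(\<gamma> b, a)\<close>, where \<open>a\<close> and \<open>b\<close> are corresponding eigenvalues of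
  \<open>P(\<mu>)\<close> and \<open>P'(\<mu>)\<close>; every \<open>b\<close> is nonzero because \<open>\<mu>\<close> is not in \<open>\<sigma>(P')\<close>. Such a block has the
  two singular values
  \<open>(sqrt (4 \<bar>a\<bar>\<^sup>2 + \<gamma>\<^sup>2 \<bar>b\<bar>\<^sup>2) \<plusminus> \<gamma> \<bar>b\<bar>) / 2\<close>,
  so the singular values of \<open>F[P(\<mu>);\<gamma>]\<close> form \<open>2n\<close> continuous branches in \<open>\<gamma>\<close>
  (\<open>weakly_normal_singular_values_F_mat\<close>). The branch with the plus sign is strictly increasing;
  the product of the two branches is the constant \<open>\<bar>a\<bar>\<^sup>2\<close>, so the branch with the minus sign is
  strictly decreasing wherever it is positive. Hence no branch with a positive value has a local
  maximum at a positive \<open>\<gamma>\<close> (\<open>block_singular_value_frequently_greater\<close>).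

  If \<open>s\<^sub>* > 0\<close> were a simple singular value, exactly one branch would pass through it at
  \<open>\<gamma>\<^sub>*\<close>. Moving \<open>\<gamma>\<close> slightly in the direction in which that branch grows lifts it above \<open>s\<^sub>*\<close>,
  while continuity keeps the larger branches above \<open>s\<^sub>*\<close>. Then at most one branch is left at or
  below \<open>s\<^sub>*\<close>, so the second smallest singular value exceeds \<open>s\<^sub>*\<close>, which contradicts maximality
  (\<open>simple_value_increases_order_statistic\<close>).
\<close>

section \<open>Adjoints and unitary equivalence\<close>

lemma mat_adjoint_carrier [simp]:
  "A \<in> carrier_mat nr nc \<Longrightarrow> mat_adjoint A \<in> carrier_mat nc nr"
  by (auto simp: mat_adjoint_def)

lemma mat_adjoint_dim [simp]:
  "dim_row (mat_adjoint A) = dim_col A" "dim_col (mat_adjoint A) = dim_row A"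
  by (auto simp: mat_adjoint_def)

lemma mat_adjoint_index [simp]:
  "i < dim_col A \<Longrightarrow> j < dim_row A \<Longrightarrow> mat_adjoint A $$ (i, j) = conjugate (A $$ (j, i))"
  by (simp add: mat_adjoint_def mat_of_rows_index)

lemma mat_adjoint_adjoint [simp]: "mat_adjoint (mat_adjoint (A :: complex mat)) = A"
  by (rule eq_matI) auto

lemma mat_adjoint_mult:
  fixes A B :: "complex mat"
  assumes "A \<in> carrier_mat nr n" "B \<in> carrier_mat n nc"
  shows "mat_adjoint (A * B) = mat_adjoint B * mat_adjoint A"
  using assms by (intro eq_matI) (auto simp: scalar_prod_def mult.commute intro!: sum.cong)

lemma mat_adjoint_four_block:
  fixes A B C D :: "complex mat"
  assumes "A \<in> carrier_mat nr1 nc1" "B \<in> carrier_mat nr1 nc2"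
    "C \<in> carrier_mat nr2 nc1" "D \<in> carrier_mat nr2 nc2"
  shows "mat_adjoint (four_block_mat A B C D)
    = four_block_mat (mat_adjoint A) (mat_adjoint C) (mat_adjoint B) (mat_adjoint D)"
  using assms by (intro eq_matI) (auto simp: carrier_matD)

lemma mat_adjoint_mat_diag:
  "mat_adjoint (mat_diag n f) = mat_diag n (\<lambda>i. cnj (f i))"
  by (rule eq_matI) (auto simp: mat_diag_def)

lemma unitary_matD:
  assumes "unitary_mat n U"
  shows "U \<in> carrier_mat n n" "mat_adjoint U * U = 1\<^sub>m n" "U * mat_adjoint U = 1\<^sub>m n"
  using assms mat_mult_left_right_inverse[of "mat_adjoint U" n U]
  by (auto simp: unitary_mat_def)

lemma unitary_mat_four_block:
  assumes "unitary_mat n U"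
  shows "unitary_mat (n + n) (four_block_mat U (0\<^sub>m n n) (0\<^sub>m n n) U)"
proof -
  note U = unitary_matD[OF assms]
  have zero: "mat_adjoint (0\<^sub>m n n) = (0\<^sub>m n n :: complex mat)"
    by (rule eq_matI) auto
  have "mat_adjoint (four_block_mat U (0\<^sub>m n n) (0\<^sub>m n n) U) * four_block_mat U (0\<^sub>m n n) (0\<^sub>m n n) U
    = four_block_mat (mat_adjoint U * U) (0\<^sub>m n n) (0\<^sub>m n n) (mat_adjoint U * U)"
    using U(1) by (simp add: mat_adjoint_four_block[of _ n n _ n _ n] zero
        mult_four_block_mat[of _ n n _ n _ n _ _ n _ n] mult_carrier_mat[of _ n n])
  then show ?thesis
    using U by (simp add: unitary_mat_def)
qed

text \<open>
  For \<open>C = V B V\<^sup>*\<close> the inner factors \<open>V\<^sup>* V\<close> of \<open>C\<^sup>* C\<close> cancel, so \<open>C\<^sup>* C\<close> is similar to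
  \<open>B\<^sup>* B\<close> and has the same characteristic polynomial.
\<close>

lemma singular_values_unitary_conjugation:
  assumes V: "unitary_mat N V" and B: "B \<in> carrier_mat N N"
  shows "singular_values (V * B * mat_adjoint V) = singular_values B"
proof -
  note V = unitary_matD[OF V]
  let ?W = "mat_adjoint V"
  have W: "?W \<in> carrier_mat N N" and B': "mat_adjoint B \<in> carrier_mat N N"
    using V(1) B by auto
  have adj: "mat_adjoint (V * B * ?W) = V * (mat_adjoint B * ?W)"
    using V(1) B W B' by (simp add: mat_adjoint_mult[of _ N N _ N] assoc_mult_mat[of _ N N _ N _ N] mult_carrier_mat[of _ N N])
  have "mat_adjoint (V * B * ?W) * (V * B * ?W) = V * mat_adjoint B * (?W * V) * (B * ?W)"
    unfolding adj using V(1) B W B' by (simp add: assoc_mult_mat[of _ N N _ N _ N] mult_carrier_mat[of _ N N])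
  also have "\<dots> = V * (mat_adjoint B * B) * ?W"
    unfolding V(2) using V(1) B W B' by (simp add: assoc_mult_mat[of _ N N _ N _ N] mult_carrier_mat[of _ N N])
  finally have eq: "mat_adjoint (V * B * ?W) * (V * B * ?W) = V * (mat_adjoint B * B) * ?W" .
  have "similar_mat (V * (mat_adjoint B * B) * ?W) (mat_adjoint B * B)"
    unfolding similar_mat_def
    by (intro exI, rule similar_mat_witI[OF V(3) V(2) refl]) (use V(1) B W B' in auto)
  from char_poly_similar[OF this] show ?thesis
    by (simp add: singular_values_def eq)
qed

section \<open>Weakly normal matrix polynomials\<close>

lemma matpoly_eval_mult:
  assumes "P \<in> carrier_mat nr n" "Q \<in> carrier_mat n nc"
  shows "matpoly_eval (P * Q) z = matpoly_eval P z * matpoly_eval Q z"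
proof -
  have "semiring_hom (\<lambda>p. poly p z)" by unfold_locales auto
  from semiring_hom.mat_hom_mult[OF this assms] show ?thesis
    by (simp add: matpoly_eval_def)
qed

lemma matpoly_eval_const [simp]: "matpoly_eval (const_matpoly B) z = B"
  by (rule eq_matI) (auto simp: matpoly_eval_def const_matpoly_def)

lemma const_matpoly_mult:
  assumes "A \<in> carrier_mat nr n" "B \<in> carrier_mat n nc"
  shows "const_matpoly (A * B) = const_matpoly A * const_matpoly B"
proof -
  have "semiring_hom (\<lambda>c :: complex. [:c:])" by unfold_locales (auto simp: one_pCons)
  from semiring_hom.mat_hom_mult[OF this assms] show ?thesis
    by (simp add: const_matpoly_def)
qed

lemma const_matpoly_one: "const_matpoly (1\<^sub>m n) = 1\<^sub>m n"
  by (rule eq_matI) (auto simp: const_matpoly_def one_pCons)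

lemma const_matpoly_carrier [simp]:
  "const_matpoly B \<in> carrier_mat nr nc \<longleftrightarrow> B \<in> carrier_mat nr nc"
  by (simp add: const_matpoly_def)

lemma matpoly_deriv_const_conj:
  assumes A: "A \<in> carrier_mat n n" and Q: "Q \<in> carrier_mat n n" and B: "B \<in> carrier_mat n n"
  shows "matpoly_deriv (const_matpoly A * Q * const_matpoly B)
    = const_matpoly A * matpoly_deriv Q * const_matpoly B"
proof -
  have pderiv_sum: "pderiv (sum f S) = (\<Sum>i\<in>S. pderiv (f i))" for f :: "nat \<Rightarrow> complex poly" and S
    by (induction S rule: infinite_finite_induct) (auto simp: pderiv_add)
  have left: "matpoly_deriv (const_matpoly A * R) = const_matpoly A * matpoly_deriv R"
    if "R \<in> carrier_mat n n" for R
    using A that by (intro eq_matI)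
      (auto simp: matpoly_deriv_def const_matpoly_def scalar_prod_def pderiv_sum pderiv_smult)
  have right: "matpoly_deriv (R * const_matpoly B) = matpoly_deriv R * const_matpoly B"
    if "R \<in> carrier_mat n n" for R
    using B that by (intro eq_matI)
      (auto simp: matpoly_deriv_def const_matpoly_def scalar_prod_def pderiv_sum pderiv_smult)
  have "const_matpoly A * Q \<in> carrier_mat n n"
    using A Q by (intro mult_carrier_mat) auto
  then show ?thesis
    using left right Q by simp
qed

lemma weakly_normal_diagonalization:
  assumes "weakly_normal n P"
  obtains U p where "unitary_mat n U"
    "P = const_matpoly U * mat_diag n p * const_matpoly (mat_adjoint U)"
proof -
  from assms obtain U where P: "P \<in> carrier_mat n n" and U: "unitary_mat n U"
    and diag: "diagonal_mat (const_matpoly (mat_adjoint U) * P * const_matpoly U)"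
    unfolding weakly_normal_def by blast
  note U' = unitary_matD[OF U]
  let ?V = "const_matpoly U" and ?W = "const_matpoly (mat_adjoint U)"
  define Q where "Q = ?W * P * ?V"
  have V: "?V \<in> carrier_mat n n" and W: "?W \<in> carrier_mat n n"
    using U' by auto
  have Q: "Q \<in> carrier_mat n n"
    using P V W unfolding Q_def by (intro mult_carrier_mat)
  have VW: "?V * ?W = 1\<^sub>m n"
    using U' by (simp add: const_matpoly_mult[of _ n n _ n, symmetric] const_matpoly_one)
  have "?V * Q * ?W = (?V * ?W) * P * (?V * ?W)"
    unfolding Q_def using P V W by (simp add: assoc_mult_mat[of _ n n _ n _ n] mult_carrier_mat[of _ n n])
  also have "\<dots> = P"
    unfolding VW using P by simp
  finally have "P = ?V * Q * ?W" by simp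
  moreover have "Q = mat_diag n (\<lambda>i. Q $$ (i, i))"
    using diag Q unfolding Q_def[symmetric]
    by (intro eq_matI) (auto simp: mat_diag_def diagonal_mat_def)
  ultimately show thesis
    using that U by metis
qed

lemma matpoly_eval_mat_diag: "matpoly_eval (mat_diag n p) z = mat_diag n (\<lambda>i. poly (p i) z)"
  by (rule eq_matI) (auto simp: matpoly_eval_def mat_diag_def)

lemma matpoly_deriv_mat_diag: "matpoly_deriv (mat_diag n p) = mat_diag n (\<lambda>i. pderiv (p i))"
  by (rule eq_matI) (auto simp: matpoly_deriv_def mat_diag_def)

lemma det_mat_diag: "det (mat_diag n f) = (\<Prod>i<n. f i)"
proof -
  have "det (mat_diag n f) = prod_list (diag_mat (mat_diag n f))"
    by (rule det_upper_triangular[of _ n]) (auto simp: mat_diag_def)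
  also have "\<dots> = (\<Prod>i<n. f i)"
    unfolding prod_list_diag_prod by (auto simp: mat_diag_def atLeast0LessThan intro!: prod.cong)
  finally show ?thesis .
qed

text \<open>
  Outside the spectrum the value of the matrix polynomial has nonzero determinant, and up to the
  determinants of the unitary factors this is the product of the values of the diagonal entries.
\<close>

lemma matpoly_spectrum_unitary_diag:
  assumes U: "unitary_mat n U"
    and Q: "Q = const_matpoly U * mat_diag n q * const_matpoly (mat_adjoint U)"
    and z: "z \<notin> matpoly_spectrum Q" and i: "i < n"
  shows "poly (q i) z \<noteq> 0"
proof -
  note U' = unitary_matD[OF U]
  have eval: "matpoly_eval Q z = U * mat_diag n (\<lambda>i. poly (q i) z) * mat_adjoint U"
    using U' unfolding Q
    by (simp add: matpoly_eval_mult[of _ n n _ n] mult_carrier_mat[of _ n n] matpoly_eval_mat_diag)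
  have Qc: "Q \<in> carrier_mat n n"
    unfolding Q using U' by (intro mult_carrier_mat) auto
  have "det (matpoly_eval Q z) \<noteq> 0"
    using z Qc by (subst det_0_iff_vec_prod_zero[of _ n])
      (auto simp: matpoly_spectrum_def matpoly_eval_def)
  then have "(\<Prod>i<n. poly (q i) z) \<noteq> 0"
    unfolding eval using U' by (simp add: det_mult[of _ n] det_mat_diag)
  then show ?thesis
    using i by simp
qed

section \<open>Singular values of a direct sum of triangular two-by-two blocks\<close>

text \<open>
  For \<open>e = 1\<close> and \<open>e = -1\<close> and \<open>\<gamma> \<ge> 0\<close> these are the larger and the smaller singular value of
  the block with rows \<open>(a, 0)\<close> and \<open>(\<gamma> b, a)\<close>. Keeping the sign as an argument makes the
  singular values of the whole matrix a family over the product \<open>{..<n} \<times> {1, -1}\<close>.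
\<close>

definition block_singular_value :: "complex \<Rightarrow> complex \<Rightarrow> real \<Rightarrow> real \<Rightarrow> real" where
  "block_singular_value a b \<gamma> e
    = (sqrt (4 * (cmod a)\<^sup>2 + \<gamma>\<^sup>2 * (cmod b)\<^sup>2) + e * (\<gamma> * cmod b)) / 2"

lemma block_singular_value_nonneg:
  assumes "e \<in> {1, -1}"
  shows "block_singular_value a b \<gamma> e \<ge> 0"
proof -
  have "\<bar>\<gamma> * cmod b\<bar> \<le> sqrt (4 * (cmod a)\<^sup>2 + \<gamma>\<^sup>2 * (cmod b)\<^sup>2)"
    by (rule real_le_rsqrt) (simp add: power_mult_distrib)
  then show ?thesis
    using assms by (auto simp: block_singular_value_def)
qed

text \<open>
  The left-hand side is the characteristic polynomial of \<open>T\<^sup>* T\<close> for the block \<open>T\<close> with rows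
  \<open>(a, 0)\<close> and \<open>(c, a)\<close>. Its roots have sum \<open>2 \<bar>a\<bar>\<^sup>2 + \<bar>c\<bar>\<^sup>2\<close>, the squared Frobenius norm of
  \<open>T\<close>, and product \<open>\<bar>a\<bar>\<^sup>4\<close>, the squared absolute determinant; the squares of the two block
  singular values have the same sum and product.
\<close>

lemma block_char_poly:
  fixes a b :: complex and \<gamma> :: real
  defines "c \<equiv> of_real \<gamma> * b"
  shows "[:- (cnj a * a + cnj c * c), 1:] * [:- (cnj a * a), 1:]
      - [:- (cnj c * a):] * [:- (cnj a * c):]
    = (\<Prod>e\<in>{1, -1}. [:- of_real ((block_singular_value a b \<gamma> e)\<^sup>2), 1:])"
proof -
  define \<alpha> where "\<alpha> = (cmod a)\<^sup>2"
  define \<beta> where "\<beta> = \<gamma>\<^sup>2 * (cmod b)\<^sup>2"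
  define u where "u = block_singular_value a b \<gamma> 1"
  define v where "v = block_singular_value a b \<gamma> (-1)"
  have sq: "(sqrt (4 * \<alpha> + \<beta>))\<^sup>2 = 4 * \<alpha> + \<beta>"
    by (simp add: \<alpha>_def \<beta>_def)
  have uv: "u = (sqrt (4 * \<alpha> + \<beta>) + \<gamma> * cmod b) / 2" "v = (sqrt (4 * \<alpha> + \<beta>) - \<gamma> * cmod b) / 2"
    by (simp_all add: u_def v_def \<alpha>_def \<beta>_def block_singular_value_def)
  have sum: "u\<^sup>2 + v\<^sup>2 = 2 * \<alpha> + \<beta>"
    unfolding uv using sq by (simp add: \<beta>_def power2_eq_square field_simps)
  have "u * v = \<alpha>"
    unfolding uv using sq by (simp add: \<beta>_def power2_eq_square field_simps)
  then have prod: "u\<^sup>2 * v\<^sup>2 = \<alpha>\<^sup>2"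
    by (metis power_mult_distrib)
  have aa: "cnj a * a = of_real \<alpha>"
    by (simp add: \<alpha>_def complex_norm_square mult.commute del: of_real_power)
  have cc: "cnj c * c = of_real \<beta>"
    unfolding mult.commute[of "cnj c"] complex_norm_square[symmetric]
    by (simp add: \<beta>_def c_def norm_mult power_mult_distrib)
  have ac: "(cnj c * a) * (cnj a * c) = of_real (\<alpha> * \<beta>)"
    using aa cc by (simp add: mult_ac) (metis mult.assoc mult.commute)
  have "[:- (cnj a * a + cnj c * c), 1:] * [:- (cnj a * a), 1:]
      - [:- (cnj c * a):] * [:- (cnj a * c):]
    = [:of_real (\<alpha>\<^sup>2), - of_real (2 * \<alpha> + \<beta>), 1:]"
    using ac unfolding aa cc by (simp add: algebra_simps power2_eq_square)
  also have "\<dots> = [:- of_real (u\<^sup>2), 1:] * [:- of_real (v\<^sup>2), 1:]"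
    unfolding sum[symmetric] prod[symmetric] by (simp add: algebra_simps)
  finally show ?thesis
    by (simp add: u_def v_def)
qed

text \<open>
  Diagonal blocks commute, so the determinant of the block matrix is that of the diagonal matrix
  \<open>(X - f) (X - k) - g h\<close>.
\<close>

lemma char_poly_four_block_mat_diag:
  fixes f g h k :: "nat \<Rightarrow> complex"
  shows "char_poly (four_block_mat (mat_diag n f) (mat_diag n g) (mat_diag n h) (mat_diag n k))
    = (\<Prod>i<n. [:- f i, 1:] * [:- k i, 1:] - [:- g i:] * [:- h i:])"
proof -
  let ?M = "four_block_mat (mat_diag n f) (mat_diag n g) (mat_diag n h) (mat_diag n k)"
  have "char_poly_matrix ?M = four_block_mat (mat_diag n (\<lambda>i. [:- f i, 1:])) (mat_diag n (\<lambda>i. [:- g i:]))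
      (mat_diag n (\<lambda>i. [:- h i:])) (mat_diag n (\<lambda>i. [:- k i, 1:]))" (is "_ = four_block_mat ?F ?G ?H ?K")
    by (rule eq_matI) (auto simp: char_poly_matrix_def mat_diag_def)
  then have "char_poly ?M = det (?F * ?K - ?G * ?H)"
    unfolding char_poly_def by (simp add: det_four_block_mat[of _ n] mult.commute)
  also have "?F * ?K - ?G * ?H = mat_diag n (\<lambda>i. [:- f i, 1:] * [:- k i, 1:] - [:- g i:] * [:- h i:])"
    unfolding mat_diag_diag by (rule eq_matI) (auto simp: mat_diag_def)
  finally show ?thesis
    by (simp add: det_mat_diag)
qed

lemma proots_prod_linear:
  fixes t :: "'i \<Rightarrow> 'a :: idom"
  assumes "finite J"
  shows "proots (\<Prod>x\<in>J. [:- t x, 1:]) = image_mset t (mset_set J)"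
  using assms
  by (induction J rule: finite_induct) (simp_all add: proots_mult del: mult_pCons_left)

lemma singular_values_block_diag:
  "singular_values (four_block_mat (mat_diag n a) (0\<^sub>m n n)
      (complex_of_real \<gamma> \<cdot>\<^sub>m mat_diag n b) (mat_diag n a))
    = image_mset (\<lambda>(i, e). block_singular_value (a i) (b i) \<gamma> e) (mset_set ({..<n} \<times> {1, -1}))"
proof -
  define c where "c = (\<lambda>i. complex_of_real \<gamma> * b i)"
  let ?I = "{..<n} \<times> {1, -1 :: real}"
  let ?t = "\<lambda>(i, e). complex_of_real ((block_singular_value (a i) (b i) \<gamma> e)\<^sup>2)"
  let ?F = "four_block_mat (mat_diag n a) (0\<^sub>m n n) (mat_diag n c) (mat_diag n a)"
  have C: "complex_of_real \<gamma> \<cdot>\<^sub>m mat_diag n b = mat_diag n c"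
    by (rule eq_matI) (auto simp: mat_diag_def c_def)
  have zero: "0\<^sub>m n n = mat_diag n (\<lambda>_. 0 :: complex)"
    by (rule eq_matI) (auto simp: mat_diag_def)
  have add: "mat_diag n f + mat_diag n g = mat_diag n (\<lambda>i. f i + g i)" for f g :: "nat \<Rightarrow> complex"
    by (rule eq_matI) (auto simp: mat_diag_def)
  have "mat_adjoint ?F * ?F = four_block_mat
      (mat_diag n (\<lambda>i. cnj (a i) * a i + cnj (c i) * c i)) (mat_diag n (\<lambda>i. cnj (c i) * a i))
      (mat_diag n (\<lambda>i. cnj (a i) * c i)) (mat_diag n (\<lambda>i. cnj (a i) * a i))"
    unfolding zero by (simp add: mat_adjoint_four_block[of _ n n _ n _ n] mat_adjoint_mat_diag
        mult_four_block_mat[of _ n n _ n _ n _ _ n _ n] mult_carrier_mat[of _ n n] add)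
  then have "char_poly (mat_adjoint ?F * ?F)
    = (\<Prod>i<n. \<Prod>e\<in>{1, -1}. [:- of_real ((block_singular_value (a i) (b i) \<gamma> e)\<^sup>2), 1:])"
    unfolding block_char_poly[symmetric] by (simp add: char_poly_four_block_mat_diag c_def)
  also have "\<dots> = (\<Prod>x\<in>?I. [:- ?t x, 1:])"
    unfolding prod.cartesian_product by (rule prod.cong) auto
  finally have cp: "char_poly (mat_adjoint ?F * ?F) = (\<Prod>x\<in>?I. [:- ?t x, 1:])" .
  have "proots (char_poly (mat_adjoint ?F * ?F)) = image_mset ?t (mset_set ?I)"
    unfolding cp by (rule proots_prod_linear) simp
  then show ?thesis
    unfolding singular_values_def C
    by (auto simp: multiset.map_comp block_singular_value_nonneg intro!: image_mset_cong)
qed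

section \<open>Order statistics of a continuous family\<close>

text \<open>
  Taking \<open>Q\<close> to be \<open>x \<le> v\<close> or \<open>x < v\<close> turns a comparison of an order statistic with \<open>v\<close>
  into a count, which depends only on the multiset and not on its enumeration.
\<close>

lemma sorted_nth_downward_closed:
  assumes "sorted xs" "j < length xs" and down: "\<And>x y :: 'a :: linorder. x \<le> y \<Longrightarrow> Q y \<Longrightarrow> Q x"
  shows "\<not> Q (xs ! j) \<longleftrightarrow> length (filter Q xs) \<le> j"
  using assms(1,2)
proof (induction xs arbitrary: j)
  case (Cons x xs)
  show ?case
  proof (cases "Q x")
    case True
    then show ?thesis
      using Cons by (cases j) auto
  next
    case False
    then have "\<not> Q y" if "y \<in> set (x # xs)" for y
      using that Cons.prems(1) down by auto
    moreover from this have "filter Q (x # xs) = []"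
      unfolding filter_empty_conv by blast
    ultimately show ?thesis
      using nth_mem[OF Cons.prems(2)] by simp
  qed
qed simp

lemma singular_value_downward_closed:
  assumes "B \<in> carrier_mat N N" "1 \<le> k" "k \<le> N" "\<And>x y. x \<le> y \<Longrightarrow> Q y \<Longrightarrow> Q x"
  shows "\<not> Q (singular_value k B) \<longleftrightarrow> size (filter_mset Q (singular_values B)) \<le> N - k"
proof -
  let ?xs = "sorted_list_of_multiset (singular_values B)"
  have len: "length ?xs = N"
    using size_singular_values[OF assms(1)] by (metis mset_sorted_list_of_multiset size_mset)
  have "singular_value k B = ?xs ! (N - k)"
    using assms len by (simp add: singular_value_def rev_nth)
  moreover have "size (filter_mset Q (singular_values B)) = length (filter Q ?xs)"
    by (metis mset_filter mset_sorted_list_of_multiset size_mset)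
  ultimately show ?thesis
    using sorted_nth_downward_closed[of ?xs "N - k" Q] assms len by simp
qed

text \<open>
  The perturbation step: if only one member of the family has the value \<open>s\<close> and it exceeds \<open>s\<close>
  at points arbitrarily close to \<open>t\<close>, then near such a point the values strictly above \<open>s\<close> stay
  there by continuity. Only members that were already below \<open>s\<close> can remain at or below it.
\<close>

lemma simple_value_increases_order_statistic:
  fixes f :: "'i \<Rightarrow> 'a :: topological_space \<Rightarrow> real"
  assumes I: "finite I"
    and cont: "\<And>k. k \<in> I \<Longrightarrow> (f k \<longlongrightarrow> f k t) (nhds t)"
    and simple: "{k \<in> I. f k t = s} = {k0}"
    and up: "\<exists>\<^sub>F u in nhds t. s < f k0 u"
    and P: "\<forall>\<^sub>F u in nhds t. P u"
  shows "\<exists>u. P u \<and> {k \<in> I. f k u \<le> s} \<subseteq> {k \<in> I. f k t < s}"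
proof -
  have "\<forall>\<^sub>F u in nhds t. s < f k u" if "k \<in> {k \<in> I. s < f k t}" for k
    using that cont by (auto intro: order_tendstoD)
  then have "\<forall>\<^sub>F u in nhds t. \<forall>k\<in>{k \<in> I. s < f k t}. s < f k u"
    using I by (subst eventually_ball_finite_distrib) auto
  then have "\<forall>\<^sub>F u in nhds t. P u \<and> (\<forall>k\<in>{k \<in> I. s < f k t}. s < f k u)"
    using P by eventually_elim auto
  from frequently_ex[OF frequently_eventually_frequently[OF up this]] obtain u
    where u: "s < f k0 u" "P u" "\<forall>k\<in>{k \<in> I. s < f k t}. s < f k u"
    by auto
  have "f k t < s" if "k \<in> I" "f k u \<le> s" for k
  proof (rule ccontr)
    assume "\<not> f k t < s"
    then consider "f k t = s" | "s < f k t" by linarith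
    then show False
    proof cases
      case 1
      then have "k = k0" using simple that by auto
      then show False using u that by auto
    next
      case 2
      then show False using u that by auto
    qed
  qed
  then show ?thesis
    using u by auto
qed

section \<open>Monotonicity of the branches\<close>

lemma block_singular_value_tendsto:
  "((\<lambda>\<gamma>. block_singular_value a b \<gamma> e) \<longlongrightarrow> block_singular_value a b \<gamma> e) (nhds \<gamma>)"
  unfolding block_singular_value_def
  by (intro tendsto_intros filterlim_ident) simp_all

lemma block_singular_value_plus_strict_mono:
  assumes "b \<noteq> 0" "0 \<le> x" "x < y"
  shows "block_singular_value a b x 1 < block_singular_value a b y 1"
proof -
  have "x\<^sup>2 \<le> y\<^sup>2" using assms by (intro power_mono) auto
  then have "sqrt (4 * (cmod a)\<^sup>2 + x\<^sup>2 * (cmod b)\<^sup>2) \<le> sqrt (4 * (cmod a)\<^sup>2 + y\<^sup>2 * (cmod b)\<^sup>2)"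
    by (simp add: mult_right_mono)
  moreover have "x * cmod b < y * cmod b" using assms by simp
  ultimately show ?thesis
    by (simp add: block_singular_value_def divide_strict_right_mono add_le_less_mono)
qed

lemma block_singular_value_product:
  "block_singular_value a b \<gamma> 1 * block_singular_value a b \<gamma> (-1) = (cmod a)\<^sup>2"
proof -
  have "(sqrt (4 * (cmod a)\<^sup>2 + \<gamma>\<^sup>2 * (cmod b)\<^sup>2))\<^sup>2 = 4 * (cmod a)\<^sup>2 + \<gamma>\<^sup>2 * (cmod b)\<^sup>2"
    by simp
  then show ?thesis
    by (simp add: block_singular_value_def field_simps power2_eq_square)
qed

text \<open>
  The product of the two branches is constant and the plus branch grows, so the minus branch must
  shrink. Positivity at one point suffices, since it forces \<open>a \<noteq> 0\<close>; for \<open>a = 0\<close> the minus branch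
  vanishes for all \<open>\<gamma> \<ge> 0\<close>.
\<close>

lemma block_singular_value_minus_strict_antimono:
  assumes "b \<noteq> 0" "0 \<le> x" "x < y" "block_singular_value a b y (-1) > 0"
  shows "block_singular_value a b y (-1) < block_singular_value a b x (-1)"
proof -
  let ?p = "\<lambda>z. block_singular_value a b z 1" and ?m = "\<lambda>z. block_singular_value a b z (-1)"
  have less: "?p x < ?p y"
    using assms by (intro block_singular_value_plus_strict_mono)
  have "?p x * ?m y < ?p y * ?m y"
    using less assms(4) by simp
  also have "\<dots> = ?p x * ?m x"
    by (simp add: block_singular_value_product)
  finally show ?thesis
    using block_singular_value_nonneg[of 1 a b x] by (simp add: mult_less_cancel_left)
qed

text \<open>
  The plus branch exceeds its value at \<open>t\<close> to the right of \<open>t\<close>, the minus branch to the left;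
  moving left is possible within the nonnegative parameters because \<open>t > 0\<close>.
\<close>

lemma block_singular_value_frequently_greater:
  assumes b: "b \<noteq> 0" and e: "e \<in> {1, -1}" and t: "0 < t" and pos: "block_singular_value a b t e > 0"
  shows "\<exists>\<^sub>F u in nhds t. block_singular_value a b t e < block_singular_value a b u e"
proof (cases "e = 1")
  case True
  have "\<forall>\<^sub>F u in at_right t. block_singular_value a b t e < block_singular_value a b u e"
    unfolding True using b t
    by (intro eventually_at_rightI[of t "t + 1"] block_singular_value_plus_strict_mono) auto
  then have "\<exists>\<^sub>F u in at_right t. block_singular_value a b t e < block_singular_value a b u e"
    by (rule eventually_frequently[rotated]) simp
  moreover have "at_right t \<le> nhds t"
    by (simp add: at_within_def)
  ultimately show ?thesis
    unfolding frequently_def by (blast dest: filter_leD)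
next
  case False
  then have e: "e = -1" using e by auto
  have "\<forall>\<^sub>F u in at_left t. block_singular_value a b t e < block_singular_value a b u e"
    unfolding e using b t pos[unfolded e]
    by (intro eventually_at_leftI[of 0] block_singular_value_minus_strict_antimono) auto
  then have "\<exists>\<^sub>F u in at_left t. block_singular_value a b t e < block_singular_value a b u e"
    by (rule eventually_frequently[rotated]) simp
  moreover have "at_left t \<le> nhds t"
    by (simp add: at_within_def)
  ultimately show ?thesis
    unfolding frequently_def by (blast dest: filter_leD)
qed

section \<open>Simple singular values at a maximum\<close>

text \<open>
  The unitary matrix \<open>U\<close> is independent of \<open>\<gamma>\<close>, so the same \<open>a\<close> and \<open>b\<close> serve for all \<open>\<gamma>\<close> and the
  singular values can be followed along branches.
\<close>

lemma weakly_normal_singular_values_F_mat: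
  assumes wn: "weakly_normal n P" and z: "z \<notin> matpoly_spectrum (matpoly_deriv P)"
  obtains a b where "\<And>i. i < n \<Longrightarrow> b i \<noteq> 0"
    "\<And>\<gamma>. singular_values (F_mat P z \<gamma>)
      = image_mset (\<lambda>(i, e). block_singular_value (a i) (b i) \<gamma> e) (mset_set ({..<n} \<times> {1, -1}))"
proof -
  obtain U p where U: "unitary_mat n U"
    and P: "P = const_matpoly U * mat_diag n p * const_matpoly (mat_adjoint U)"
    using weakly_normal_diagonalization[OF wn] .
  note U' = unitary_matD[OF U]
  define a b where "a i = poly (p i) z" and "b i = poly (pderiv (p i)) z" for i
  let ?W = "mat_adjoint U"
  have W: "?W \<in> carrier_mat n n" using U' by simp
  have deriv: "matpoly_deriv P = const_matpoly U * mat_diag n (\<lambda>i. pderiv (p i)) * const_matpoly ?W"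
    unfolding P using U' by (simp add: matpoly_deriv_const_conj[of _ n] matpoly_deriv_mat_diag)
  have eval: "matpoly_eval P z = U * mat_diag n a * ?W"
    unfolding P a_def using U'
    by (simp add: matpoly_eval_mult[of _ n n _ n] mult_carrier_mat[of _ n n] matpoly_eval_mat_diag)
  have eval': "matpoly_eval (matpoly_deriv P) z = U * mat_diag n b * ?W"
    unfolding deriv b_def using U'
    by (simp add: matpoly_eval_mult[of _ n n _ n] mult_carrier_mat[of _ n n] matpoly_eval_mat_diag)
  have dim: "dim_row P = n" "dim_col P = n"
    using wn by (auto simp: weakly_normal_def)
  let ?V = "four_block_mat U (0\<^sub>m n n) (0\<^sub>m n n) U"
  let ?D = "\<lambda>\<gamma>. four_block_mat (mat_diag n a) (0\<^sub>m n n) (complex_of_real \<gamma> \<cdot>\<^sub>m mat_diag n b) (mat_diag n a)"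
  have zero: "mat_adjoint (0\<^sub>m n n) = (0\<^sub>m n n :: complex mat)"
    by (rule eq_matI) auto
  have F: "F_mat P z \<gamma> = ?V * ?D \<gamma> * mat_adjoint ?V" for \<gamma>
  proof -
    let ?B = "complex_of_real \<gamma> \<cdot>\<^sub>m mat_diag n b"
    have carrier: "U \<in> carrier_mat n n" "?W \<in> carrier_mat n n" "?B \<in> carrier_mat n n"
      "mat_diag n a \<in> carrier_mat n n" "0\<^sub>m n n \<in> carrier_mat n n"
      using U'(1) W by auto
    have "?V * ?D \<gamma> * mat_adjoint ?V = four_block_mat (U * mat_diag n a * ?W) (0\<^sub>m n n)
        (U * ?B * ?W) (U * mat_diag n a * ?W)"
      using carrier by (simp add: mat_adjoint_four_block[of _ n n _ n _ n] zero
          mult_four_block_mat[of _ n n _ n _ n _ _ n _ n] mult_carrier_mat[of _ n n]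
          left_mult_zero_mat[of _ n n] right_mult_zero_mat[of _ n n]
          del: mult_smult_distrib mult_smult_assoc_mat)
    also have "U * ?B * ?W = complex_of_real \<gamma> \<cdot>\<^sub>m (U * mat_diag n b * ?W)"
      using U'(1) W by (simp add: mult_smult_distrib[of _ n n _ n] mult_carrier_mat[of _ n n]
          mult_smult_assoc_mat[of _ n n _ n])
    finally show ?thesis
      unfolding F_mat_def eval eval' dim by simp
  qed
  have "singular_values (F_mat P z \<gamma>)
      = image_mset (\<lambda>(i, e). block_singular_value (a i) (b i) \<gamma> e) (mset_set ({..<n} \<times> {1, -1}))" for \<gamma>
    unfolding F singular_values_block_diag[symmetric]
    by (rule singular_values_unitary_conjugation[OF unitary_mat_four_block[OF U]]) simp
  moreover have "b i \<noteq> 0" if "i < n" for i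
    unfolding b_def by (rule matpoly_spectrum_unitary_diag[OF U deriv z that])
  ultimately show thesis
    using that by blast
qed

theorem theorem3p1:
  fixes n m :: nat and A :: "nat \<Rightarrow> complex mat" and P :: "complex poly mat"
    and \<mu> :: complex and \<gamma>' s' :: real
  assumes "n \<ge> 1"
    and "\<And>j. j \<le> m \<Longrightarrow> A j \<in> carrier_mat n n"
    and "P = matpoly n m A"
    and "weakly_normal n P"
    and "det (A m) \<noteq> 0"
    and "\<mu> \<notin> matpoly_spectrum (matpoly_deriv P)"
    and "\<gamma>' > 0"
    and "\<And>\<gamma>. \<gamma> \<ge> 0 \<Longrightarrow>
           singular_value (2 * n - 1) (F_mat P \<mu> \<gamma>) \<le> singular_value (2 * n - 1) (F_mat P \<mu> \<gamma>')"
    and "s' = singular_value (2 * n - 1) (F_mat P \<mu> \<gamma>')"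
    and "s' > 0"
  shows "count (singular_values (F_mat P \<mu> \<gamma>')) s' \<ge> 2"
proof (rule ccontr)
  assume "\<not> ?thesis"
  obtain a b where b: "\<And>i. i < n \<Longrightarrow> b i \<noteq> 0"
    and sv: "\<And>\<gamma>. singular_values (F_mat P \<mu> \<gamma>)
      = image_mset (\<lambda>(i, e). block_singular_value (a i) (b i) \<gamma> e) (mset_set ({..<n} \<times> {1, -1}))"
    using weakly_normal_singular_values_F_mat[OF assms(4,6)] by metis
  define I where "I = {..<n} \<times> {1, -1 :: real}"
  define f where "f k \<gamma> = (case k of (i, e) \<Rightarrow> block_singular_value (a i) (b i) \<gamma> e)" for k \<gamma>
  have I: "finite I"
    by (simp add: I_def)
  have size: "size (filter_mset Q (singular_values (F_mat P \<mu> \<gamma>))) = card {k \<in> I. Q (f k \<gamma>)}" for Q \<gamma>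
    using I unfolding sv I_def[symmetric] f_def
    by (simp add: filter_mset_image_mset case_prod_unfold)
  have Pc: "P \<in> carrier_mat n n"
    using assms(4) by (simp add: weakly_normal_def)
  have F: "F_mat P \<mu> \<gamma> \<in> carrier_mat (2 * n) (2 * n)" for \<gamma>
    using Pc by (simp add: F_mat_def matpoly_eval_def mult_2)
  \<comment> \<open>Position \<open>2n - 1\<close> from the top is the second smallest, hence the bound \<open>1\<close>.\<close>
  have order: "\<not> Q (singular_value (2 * n - 1) (F_mat P \<mu> \<gamma>)) \<longleftrightarrow> card {k \<in> I. Q (f k \<gamma>)} \<le> 1"
    if "\<And>x y. x \<le> y \<Longrightarrow> Q y \<Longrightarrow> Q x" for Q \<gamma>
    using singular_value_downward_closed[OF F, of "2 * n - 1" Q \<gamma>] that assms(1)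
    unfolding size by auto
  have below: "card {k \<in> I. f k \<gamma>' < s'} \<le> 1"
    using order[of "\<lambda>x. x < s'" \<gamma>'] assms(9) by auto
  have "\<not> card {k \<in> I. f k \<gamma>' \<le> s'} \<le> 1"
    using order[of "\<lambda>x. x \<le> s'" \<gamma>'] assms(9) by auto
  moreover have "{k \<in> I. f k \<gamma>' \<le> s'} = {k \<in> I. f k \<gamma>' < s'} \<union> {k \<in> I. f k \<gamma>' = s'}"
    by auto
  ultimately have "\<not> card ({k \<in> I. f k \<gamma>' < s'} \<union> {k \<in> I. f k \<gamma>' = s'}) \<le> 1"
    by simp
  then have ne: "{k \<in> I. f k \<gamma>' = s'} \<noteq> {}"
    using below by (intro notI) (simp only: Un_empty_right simp_thms)
  have "card {k \<in> I. f k \<gamma>' = s'} = count (singular_values (F_mat P \<mu> \<gamma>')) s'"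
    using size[of "\<lambda>x. x = s'" \<gamma>'] by (simp add: filter_eq_replicate_mset)
  with \<open>\<not> ?thesis\<close> have "card {k \<in> I. f k \<gamma>' = s'} < 2" by simp
  moreover have "card {k \<in> I. f k \<gamma>' = s'} \<noteq> 0"
    using ne I by simp
  ultimately have "card {k \<in> I. f k \<gamma>' = s'} = 1" by linarith
  then obtain k0 where k0: "{k \<in> I. f k \<gamma>' = s'} = {k0}"
    by (auto simp: card_1_singleton_iff)
  then have k0': "k0 \<in> I" "f k0 \<gamma>' = s'" by auto
  have up: "\<exists>\<^sub>F u in nhds \<gamma>'. s' < f k0 u"
    using k0' b assms(7,10) unfolding f_def I_def
    by (auto intro!: block_singular_value_frequently_greater)
  have "(f k \<longlongrightarrow> f k \<gamma>') (nhds \<gamma>')" for k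
    by (cases k) (simp add: f_def[abs_def] block_singular_value_tendsto)
  moreover have "\<forall>\<^sub>F u in nhds \<gamma>'. 0 < u"
    using order_tendstoD(1)[OF filterlim_ident assms(7)] .
  ultimately obtain u where u: "0 < u" "{k \<in> I. f k u \<le> s'} \<subseteq> {k \<in> I. f k \<gamma>' < s'}"
    using simple_value_increases_order_statistic[OF I _ k0 up] by blast
  have "card {k \<in> I. f k u \<le> s'} \<le> 1"
    using card_mono[OF _ u(2)] I below by force
  then have "s' < singular_value (2 * n - 1) (F_mat P \<mu> u)"
    using order[of "\<lambda>x. x \<le> s'" u] by auto
  then show False
    using assms(8)[of u] assms(9) u(1) by simp
qed

end
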